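(* For any triangle $\vec z=(z_1,z_2,z_3)$ in the complex plane, with unbalance factor $K$, $$K=\sqrt{\frac{d(\mathbb C^*\vec z+\mathbb C,\triangle)^2}{1-d(\mathbb C^*\vec z+\mathbb C,\triangle)^2}}\qquad\text{and}\qquad d(\mathbb C^*\vec z+\mathbb C,\triangle)=\sqrt{\frac{K^2}{1+K^2}}.$$
   Context: A triangle is any triple $\vec z=(z_1,z_2,z_3)$ of points of $\mathbb C$ (degenerate ones allowed). The unbalance factor of $\vec z$ is the ratio of the absolute values of its negative and positive components, $$K=\frac{\big|z_1+z_2e^{\frac{2\pi}3i}+z_3e^{-\frac{2\pi}3i}\big|}{\big|z_1+z_2e^{-\frac{2\pi}3i}+z_3e^{\frac{2\pi}3i}\big|}.$$ $\mathbb C^*=\mathbb C\setminus\{0\}$. For $\vec x,\vec y\in\mathbb C^n$, $d(\vec x,\vec y)=\big(\sum_{k=1}^n|x_k-y_k|^2\big)^{1/2}$; for $a,b\in\mathbb C$, $a\vec x+b=(ax_1+b,\dots,ax_n+b)$. The affine deviation of $\vec x$ from $\vec y$ is $d(\mathbb C^*\vec x+\mathbb C,\vec y)=\inf\{d(a\vec x+b,\vec y):a\in\mathbb C^*,\ b\in\mathbb C\}$. $\triangle=\frac1{\sqrt3}\big(1,e^{i2\pi/3},e^{-i2\pi/3}\big)\in\mathbb C^3$ is the model regular triangle with sides of length 1. *)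

theory Defs
  imports "HOL-Analysis.Analysis"
begin

definition negative_component_abs :: "complex ^ 3 \<Rightarrow> real" where
  "negative_component_abs z =
     cmod (z $ 1 + z $ 2 * exp (2 * pi / 3 * \<i>) + z $ 3 * exp (- (2 * pi / 3) * \<i>))"

definition positive_component_abs :: "complex ^ 3 \<Rightarrow> real" where
  "positive_component_abs z =
     cmod (z $ 1 + z $ 2 * exp (- (2 * pi / 3) * \<i>) + z $ 3 * exp (2 * pi / 3 * \<i>))"

text \<open>
  The denominator vanishes for negatively oriented regular triangles and for triples
  of three equal points. The factor is then \<open>\<infinity>\<close>, so in particular the
  otherwise undefined quotient \<open>0 / 0\<close> of a one-point triangle is \<open>\<infinity>\<close>.
\<close>
definition unbalance_factor :: "complex ^ 3 \<Rightarrow> ereal" where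
  "unbalance_factor z =
     (if positive_component_abs z = 0 then \<infinity>
      else ereal (negative_component_abs z / positive_component_abs z))"

text \<open>
  The library's \<^const>\<open>dist\<close> on finite Cartesian products is the
  Euclidean (\<open>L\<^sup>2\<close>) distance.
\<close>
definition affine_deviation :: "complex ^ 'n \<Rightarrow> complex ^ 'n \<Rightarrow> real" where
  "affine_deviation x y =
     Inf {dist (\<chi> k. a * x $ k + b) y | a b. a \<noteq> 0}"

definition model_triangle :: "complex ^ 3" where
  "model_triangle =
     (1 / sqrt 3) *\<^sub>R vector [1, exp (2 * pi / 3 * \<i>), exp (- (2 * pi / 3) * \<i>)]"

text \<open>Only applied to nonnegative arguments; the value at \<open>-\<infinity>\<close> is irrelevant.\<close>
definition ereal_sqrt :: "ereal \<Rightarrow> ereal" where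
  "ereal_sqrt x = (case x of ereal r \<Rightarrow> ereal (sqrt r) | PInfty \<Rightarrow> \<infinity> | MInfty \<Rightarrow> -\<infinity>)"

text \<open>
  The function \<open>K\<^sup>2 / (1 + K\<^sup>2)\<close> on \<open>[0, \<infinity>]\<close>, with its
  limit \<open>1\<close> at \<open>\<infinity>\<close>; the library's \<^typ>\<open>ereal\<close> division would give
  \<open>\<infinity> / \<infinity> = 0\<close> there. No such care is needed for \<open>1 / 0\<close>, which is
  \<open>\<infinity>\<close> in \<^typ>\<open>ereal\<close>.
\<close>
definition square_ratio :: "ereal \<Rightarrow> ereal" where
  "square_ratio K = (if K = \<infinity> then 1 else K\<^sup>2 / (1 + K\<^sup>2))"

end

theory Submission
  imports Defs
begin

text \<open>
  The discrete Fourier transform of a triangle \<open>z\<close> has three coefficients: the sum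
  \<open>s\<close> of its vertices, and the complex numbers \<open>p\<close> and \<open>n\<close> whose absolute values are the positive
  and the negative component. Parseval's identity splits the squared distance
  between \<open>a z + b\<close> and the model triangle, whose only nonzero coefficient is
  \<open>p = \<surd>3\<close>, into

    \<open>3 d\<^sup>2 = \<bar>a s + 3 b\<bar>\<^sup>2 + \<bar>a p - \<surd>3\<bar>\<^sup>2 + \<bar>a n\<bar>\<^sup>2\<close>.

  This is \<open>dist_affine_image_model_triangle\<close>. The translation \<open>b\<close> serves only to remove the
  first term. What remains is a quadratic function of \<open>a\<close>, and completing the square
  (\<open>complete_square_complex\<close>) shows that for \<open>p \<noteq> 0\<close> it is smallest at a nonzero multiple of the
  conjugate of \<open>p\<close>. Hence \<open>D\<^sup>2 = \<bar>n\<bar>\<^sup>2 / (\<bar>p\<bar>\<^sup>2 + \<bar>n\<bar>\<^sup>2)\<close>, and both formulas follow from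
  \<open>K = \<bar>n\<bar> / \<bar>p\<bar>\<close>. If \<open>p = 0\<close>, no \<open>a\<close> brings the distance below \<open>1\<close>, and letting \<open>a\<close> tend
  to \<open>0\<close> shows that \<open>D = 1\<close>; this agrees with \<open>K = \<infinity>\<close>.
\<close>

section \<open>The Fourier components of a triangle\<close>

definition omega :: complex where
  "omega = exp (2 * pi / 3 * \<i>)"

definition positive_component :: "complex ^ 3 \<Rightarrow> complex" where
  "positive_component z = z $ 1 + z $ 2 * cnj omega + z $ 3 * omega"

definition negative_component :: "complex ^ 3 \<Rightarrow> complex" where
  "negative_component z = z $ 1 + z $ 2 * omega + z $ 3 * cnj omega"

lemma exp_minus_eq_cnj_omega: "exp (- (2 * pi / 3) * \<i>) = cnj omega"
  by (simp add: omega_def exp_cnj)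

lemma positive_component_abs_eq: "positive_component_abs z = cmod (positive_component z)"
  using exp_minus_eq_cnj_omega
  by (simp add: positive_component_abs_def positive_component_def omega_def)

lemma negative_component_abs_eq: "negative_component_abs z = cmod (negative_component z)"
  using exp_minus_eq_cnj_omega
  by (simp add: negative_component_abs_def negative_component_def omega_def)

lemma omega_eq: "omega = Complex (- 1 / 2) (sqrt 3 / 2)"
proof -
  have "omega = cis (2 * pi / 3)"
    by (simp add: omega_def cis_conv_exp mult.commute)
  then show ?thesis
    by (simp add: complex_eq_iff cos_120 sin_120)
qed

lemma omega_mult_cnj: "omega * cnj omega = 1"
  by (simp add: omega_eq complex_eq_iff)

lemma omega_sum: "1 + omega + cnj omega = 0"
  by (simp add: omega_eq complex_eq_iff)

lemma omega_square: "omega * omega = cnj omega"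
  by (simp add: omega_eq complex_eq_iff)

lemma cnj_omega_square: "cnj omega * cnj omega = omega"
  by (simp add: omega_eq complex_eq_iff)

text \<open>
  Parseval's identity for the Fourier transform on \<open>\<int>/3\<int>\<close>: the characters
  \<open>(1, 1, 1)\<close>, \<open>(1, \<omega>, \<omega>\<^sup>2)\<close> and \<open>(1, \<omega>\<^sup>2, \<omega>)\<close> are orthogonal of squared length \<open>3\<close>.
\<close>

lemma parseval_triangle:
  fixes x :: "complex ^ 3"
  shows "3 * (norm x)\<^sup>2 = (cmod (x $ 1 + x $ 2 + x $ 3))\<^sup>2
    + (cmod (positive_component x))\<^sup>2 + (cmod (negative_component x))\<^sup>2"
proof -
  have "(norm x)\<^sup>2 = (cmod (x $ 1))\<^sup>2 + (cmod (x $ 2))\<^sup>2 + (cmod (x $ 3))\<^sup>2"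
    by (simp add: norm_vec_def L2_set_def sum_3)
  moreover have "complex_of_real (3 * ((cmod u)\<^sup>2 + (cmod v)\<^sup>2 + (cmod w)\<^sup>2))
      = of_real ((cmod (u + v + w))\<^sup>2 + (cmod (u + v * cnj omega + w * omega))\<^sup>2
        + (cmod (u + v * omega + w * cnj omega))\<^sup>2)" for u v w
    using omega_mult_cnj omega_sum
    unfolding of_real_add of_real_mult complex_norm_square
      complex_cnj_add complex_cnj_mult complex_cnj_cnj of_real_numeral
    by algebra
  ultimately show ?thesis
    unfolding positive_component_def negative_component_def
    by (simp only: of_real_eq_iff)
qed

section \<open>The distance to the model triangle\<close>

lemma model_triangle_nth:
  "model_triangle $ 1 = of_real (1 / sqrt 3)"
  "model_triangle $ 2 = of_real (1 / sqrt 3) * omega"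
  "model_triangle $ 3 = of_real (1 / sqrt 3) * cnj omega"
  unfolding model_triangle_def vector_scaleR_component
  using exp_minus_eq_cnj_omega
  by (simp_all add: omega_def scaleR_conv_of_real)

lemma model_triangle_sum: "model_triangle $ 1 + model_triangle $ 2 + model_triangle $ 3 = 0"
proof -
  have "model_triangle $ 1 + model_triangle $ 2 + model_triangle $ 3
      = of_real (1 / sqrt 3) * (1 + omega + cnj omega)"
    unfolding model_triangle_nth by (simp only: distrib_left mult_1_right)
  then show ?thesis
    by (simp add: omega_sum)
qed

lemma positive_component_model_triangle: "positive_component model_triangle = of_real (sqrt 3)"
proof -
  have "positive_component model_triangle = of_real (1 / sqrt 3) * (1 + 2 * (omega * cnj omega))"
    unfolding positive_component_def model_triangle_nth by (simp add: algebra_simps)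
  also have "\<dots> = of_real (3 / sqrt 3)"
    by (simp add: omega_mult_cnj)
  also have "\<dots> = of_real (sqrt 3)"
    by (simp add: real_div_sqrt)
  finally show ?thesis .
qed

lemma negative_component_model_triangle: "negative_component model_triangle = 0"
proof -
  have "negative_component model_triangle
      = of_real (1 / sqrt 3) * (1 + omega * omega + cnj omega * cnj omega)"
    unfolding negative_component_def model_triangle_nth by (simp add: algebra_simps)
  also have "\<dots> = of_real (1 / sqrt 3) * (1 + omega + cnj omega)"
    by (simp only: omega_square cnj_omega_square add_ac)
  finally show ?thesis
    by (simp add: omega_sum)
qed

lemma components_affine_image_diff:
  "positive_component ((\<chi> k. a * z $ k + b) - y) = a * positive_component z - positive_component y"
  "negative_component ((\<chi> k. a * z $ k + b) - y) = a * negative_component z - negative_component y"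
proof -
  have b: "b + b * omega + b * cnj omega = 0"
    using arg_cong[OF omega_sum, of "\<lambda>t. b * t"] by (simp add: algebra_simps)
  have "positive_component ((\<chi> k. a * z $ k + b) - y)
      = a * positive_component z - positive_component y + (b + b * omega + b * cnj omega)"
    by (simp add: positive_component_def algebra_simps)
  then show "positive_component ((\<chi> k. a * z $ k + b) - y)
      = a * positive_component z - positive_component y"
    by (simp only: b add_0_right)
  have "negative_component ((\<chi> k. a * z $ k + b) - y)
      = a * negative_component z - negative_component y + (b + b * omega + b * cnj omega)"
    by (simp add: negative_component_def algebra_simps)
  then show "negative_component ((\<chi> k. a * z $ k + b) - y)
      = a * negative_component z - negative_component y"
    by (simp only: b add_0_right)
qed

lemma dist_affine_image_model_triangle:
  "3 * (dist (\<chi> k. a * z $ k + b) model_triangle)\<^sup>2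
    = (cmod (a * (z $ 1 + z $ 2 + z $ 3) + 3 * b))\<^sup>2
    + (cmod (a * positive_component z - of_real (sqrt 3)))\<^sup>2
    + (cmod (a * negative_component z))\<^sup>2"
proof -
  let ?x = "(\<chi> k. a * z $ k + b) - model_triangle"
  have "?x $ 1 + ?x $ 2 + ?x $ 3 = a * (z $ 1 + z $ 2 + z $ 3) + 3 * b
      - (model_triangle $ 1 + model_triangle $ 2 + model_triangle $ 3)"
    by (simp add: algebra_simps)
  then have "?x $ 1 + ?x $ 2 + ?x $ 3 = a * (z $ 1 + z $ 2 + z $ 3) + 3 * b"
    by (simp only: model_triangle_sum diff_0_right)
  then show ?thesis
    by (simp only: dist_norm parseval_triangle components_affine_image_diff diff_0_right
        positive_component_model_triangle negative_component_model_triangle)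
qed

text \<open>
  Completing the square in \<open>a\<close>; multiplying through by the leading coefficient
  keeps the identity valid when \<open>p = n = 0\<close>.
\<close>

lemma complete_square_complex:
  fixes a p n :: complex and c :: real
  defines "S \<equiv> (cmod p)\<^sup>2 + (cmod n)\<^sup>2"
  shows "S * ((cmod (a * p - of_real c))\<^sup>2 + (cmod (a * n))\<^sup>2)
    = (cmod (of_real S * a - of_real c * cnj p))\<^sup>2 + c\<^sup>2 * (cmod n)\<^sup>2"
proof -
  have "complex_of_real (S * ((cmod (a * p - of_real c))\<^sup>2 + (cmod (a * n))\<^sup>2))
    = of_real ((cmod (of_real S * a - of_real c * cnj p))\<^sup>2 + c\<^sup>2 * (cmod n)\<^sup>2)"
    unfolding S_def of_real_add of_real_mult complex_norm_square of_real_power[of c]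
      complex_cnj_add complex_cnj_diff complex_cnj_mult complex_cnj_cnj complex_cnj_complex_of_real
    by algebra
  then show ?thesis
    by (simp only: of_real_eq_iff)
qed

section \<open>The infimum over all affine images\<close>

lemma affine_deviation_nondegenerate:
  assumes "positive_component z \<noteq> 0"
  shows "affine_deviation z model_triangle
    = sqrt ((cmod (negative_component z))\<^sup>2
        / ((cmod (positive_component z))\<^sup>2 + (cmod (negative_component z))\<^sup>2))"
proof -
  define p n where "p = positive_component z" and "n = negative_component z"
  define s where "s = z $ 1 + z $ 2 + z $ 3"
  define S where "S = (cmod p)\<^sup>2 + (cmod n)\<^sup>2"
  define d where "d a b = dist (\<chi> k. a * z $ k + b) model_triangle" for a b
  have p: "p \<noteq> 0"
    using assms by (simp add: p_def)
  have S: "S > 0"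
    unfolding S_def using p by (simp add: add_pos_nonneg)
  have d: "3 * (S * (d a b)\<^sup>2) = S * (cmod (a * s + 3 * b))\<^sup>2
      + (cmod (of_real S * a - of_real (sqrt 3) * cnj p))\<^sup>2 + 3 * (cmod n)\<^sup>2" for a b
  proof -
    have "3 * (d a b)\<^sup>2 = (cmod (a * s + 3 * b))\<^sup>2
        + ((cmod (a * p - of_real (sqrt 3)))\<^sup>2 + (cmod (a * n))\<^sup>2)"
      using dist_affine_image_model_triangle[of a z b] by (simp add: d_def p_def n_def s_def)
    then have "S * (3 * (d a b)\<^sup>2) = S * (cmod (a * s + 3 * b))\<^sup>2
        + S * ((cmod (a * p - of_real (sqrt 3)))\<^sup>2 + (cmod (a * n))\<^sup>2)"
      by (simp only: distrib_left)
    then show ?thesis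
      using complete_square_complex[of p n a "sqrt 3"] by (simp add: S_def)
  qed
  have "Inf {d a b |a b. a \<noteq> 0} = sqrt ((cmod n)\<^sup>2 / S)"
  proof (rule cInf_eq_minimum)
    fix t assume "t \<in> {d a b |a b. a \<noteq> 0}"
    then obtain a b where t: "t = d a b" by auto
    have "(cmod n)\<^sup>2 \<le> S * t\<^sup>2"
      using d[of a b] S unfolding t by (smt (verit) mult_nonneg_nonneg zero_le_power2)
    then have "(cmod n)\<^sup>2 / S \<le> t\<^sup>2"
      using S by (simp add: divide_le_eq mult.commute)
    then show "sqrt ((cmod n)\<^sup>2 / S) \<le> t"
      by (simp add: real_le_lsqrt t d_def)
  next
    \<comment> \<open>The zero of both squares on the right-hand side of fact \<open>d\<close>.\<close>
    define a where "a = of_real (sqrt 3) * cnj p / of_real S"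
    define b where "b = - a * s / 3"
    have "of_real S * a = of_real (sqrt 3) * cnj p" "a * s + 3 * b = 0"
      using S by (simp_all add: a_def b_def)
    then have "S * (d a b)\<^sup>2 = (cmod n)\<^sup>2"
      using d[of a b] by simp
    then have "(d a b)\<^sup>2 = (cmod n)\<^sup>2 / S"
      using S by (simp add: field_simps)
    then have "d a b = sqrt ((cmod n)\<^sup>2 / S)"
      by (simp add: d_def real_sqrt_unique)
    moreover have "a \<noteq> 0"
      using p S by (simp add: a_def)
    ultimately show "sqrt ((cmod n)\<^sup>2 / S) \<in> {d a b |a b. a \<noteq> 0}"
      by (metis (mono_tags, lifting) mem_Collect_eq)
  qed
  then show ?thesis
    by (simp add: affine_deviation_def d_def S_def p_def n_def)
qed

text \<open>
  Without a positive component, \<open>3 d\<^sup>2 \<ge> 3 + \<bar>a n\<bar>\<^sup>2\<close> with equality once the centroids agree,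
  so shrinking the triangle to the centre of the model triangle gives the infimum \<open>1\<close>.
  It need not be attained, because \<open>a = 0\<close> is excluded.
\<close>

lemma affine_deviation_degenerate:
  assumes "positive_component z = 0"
  shows "affine_deviation z model_triangle = 1"
proof -
  define n where "n = negative_component z"
  define s where "s = z $ 1 + z $ 2 + z $ 3"
  define d where "d a b = dist (\<chi> k. a * z $ k + b) model_triangle" for a b
  have d: "3 * (d a b)\<^sup>2 = (cmod (a * s + 3 * b))\<^sup>2 + 3 + (cmod (a * n))\<^sup>2" for a b
    using dist_affine_image_model_triangle[of a z b] assms
    by (simp add: d_def n_def s_def)
  have "Inf {d a b |a b. a \<noteq> 0} = 1"
  proof (rule cInf_eq_non_empty)
    show "{d a b |a b. a \<noteq> 0} \<noteq> {}"
      using zero_neq_one by blast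
  next
    fix t assume "t \<in> {d a b |a b. a \<noteq> 0}"
    then obtain a b where t: "t = d a b" by auto
    have "1\<^sup>2 \<le> t\<^sup>2"
      using d[of a b] unfolding t by (smt (verit) one_power2 zero_le_power2)
    then show "1 \<le> t"
      by (rule power2_le_imp_le) (simp add: t d_def)
  next
    fix y assume y: "\<And>t. t \<in> {d a b |a b. a \<noteq> 0} \<Longrightarrow> y \<le> t"
    show "y \<le> 1"
    proof (rule field_le_epsilon)
      fix e :: real assume e: "e > 0"
      \<comment> \<open>A nonzero scaling factor so small that \<open>\<bar>a n\<bar> \<le> e\<close>.\<close>
      define r where "r = e / (1 + cmod n)"
      have den: "1 + cmod n > 0" by (simp add: add_pos_nonneg)
      have r: "r > 0" using e den by (simp add: r_def)
      define a b where "a = complex_of_real r" and "b = - a * s / 3"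
      have "cmod (a * n) = r * cmod n"
        using r by (simp add: a_def norm_mult)
      also have "\<dots> \<le> r * (1 + cmod n)"
        using r by simp
      also have "\<dots> = e"
        using den by (simp add: r_def)
      finally have "(cmod (a * n))\<^sup>2 \<le> e\<^sup>2"
        by (simp add: power_mono)
      moreover have "a * s + 3 * b = 0"
        by (simp add: b_def)
      ultimately have "3 * (d a b)\<^sup>2 \<le> 3 + e\<^sup>2"
        using d[of a b] by simp
      also have "\<dots> \<le> 3 * (1 + e)\<^sup>2"
        using e by (simp add: power2_eq_square algebra_simps)
      finally have "d a b \<le> 1 + e"
        using e by (auto intro: power2_le_imp_le)
      moreover have "a \<noteq> 0"
        using r by (simp add: a_def)
      then have "y \<le> d a b"
        by (intro y) blast
      ultimately show "y \<le> 1 + e" by simp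
    qed
  qed
  then show ?thesis
    by (simp add: affine_deviation_def d_def)
qed

section \<open>Unbalance factor and affine deviation\<close>

theorem corollary2:
  fixes z :: "complex ^ 3" and K :: ereal and D :: real
  assumes "K = unbalance_factor z"
    and "D = affine_deviation z model_triangle"
  shows "K = ereal_sqrt (ereal (D\<^sup>2) / ereal (1 - D\<^sup>2)) \<and>
    ereal D = ereal_sqrt (square_ratio K)"
proof (cases "positive_component z = 0")
  case True
  then have "K = \<infinity>" "D = 1"
    using assms
    by (simp_all add: unbalance_factor_def positive_component_abs_eq affine_deviation_degenerate)
  moreover have "ereal 1 / ereal 0 = \<infinity>"
    by (simp add: divide_ereal_def)
  moreover have "ereal_sqrt \<infinity> = \<infinity>"
    unfolding ereal_sqrt_def infinity_ereal_def by (simp only: ereal.case)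
  moreover have "ereal_sqrt 1 = ereal 1"
    by (simp add: ereal_sqrt_def one_ereal_def)
  ultimately show ?thesis
    by (simp add: square_ratio_def)
next
  case False
  define p n where "p = cmod (positive_component z)" and "n = cmod (negative_component z)"
  have p: "p > 0" and n: "n \<ge> 0"
    using False by (simp_all add: p_def n_def)
  have K: "K = ereal (n / p)"
    using assms(1) False by (simp add: unbalance_factor_def positive_component_abs_eq
        negative_component_abs_eq p_def n_def)
  have D: "D = sqrt (n\<^sup>2 / (p\<^sup>2 + n\<^sup>2))"
    using assms(2) affine_deviation_nondegenerate[OF False] by (simp add: p_def n_def)
  have S: "p\<^sup>2 + n\<^sup>2 > 0"
    using p by (simp add: add_pos_nonneg)
  have D2: "D\<^sup>2 = n\<^sup>2 / (p\<^sup>2 + n\<^sup>2)"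
    using S by (simp add: D)
  have D2': "1 - D\<^sup>2 = p\<^sup>2 / (p\<^sup>2 + n\<^sup>2)"
  proof -
    have "p\<^sup>2 / (p\<^sup>2 + n\<^sup>2) + n\<^sup>2 / (p\<^sup>2 + n\<^sup>2) = 1"
      unfolding add_divide_distrib[symmetric] using p by (intro divide_self) simp
    then show ?thesis
      by (simp add: D2)
  qed
  have "D\<^sup>2 / (1 - D\<^sup>2) = (n / p)\<^sup>2"
    unfolding D2' unfolding D2 using S p by (simp add: power_divide)
  moreover have "1 - D\<^sup>2 \<noteq> 0"
    unfolding D2' using S p by simp
  ultimately have 1: "ereal_sqrt (ereal (D\<^sup>2) / ereal (1 - D\<^sup>2)) = ereal (n / p)"
    using p n by (simp add: ereal_sqrt_def)
  have pos: "1 + (n / p)\<^sup>2 > 0"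
    by (simp add: add_pos_nonneg)
  have "(n / p)\<^sup>2 / (1 + (n / p)\<^sup>2) = n\<^sup>2 / (p\<^sup>2 + n\<^sup>2)"
  proof -
    have "1 + (n / p)\<^sup>2 = (p\<^sup>2 + n\<^sup>2) / p\<^sup>2"
      using p by (simp add: power_divide add_divide_distrib)
    then show ?thesis
      using p by (simp add: power_divide)
  qed
  moreover have "square_ratio K = ereal ((n / p)\<^sup>2 / (1 + (n / p)\<^sup>2))"
    using pos by (simp add: square_ratio_def K one_ereal_def del: power_divide)
  ultimately have "ereal_sqrt (square_ratio K) = ereal D"
    by (simp add: ereal_sqrt_def D)
  with 1 K show ?thesis
    by simp
qed

end
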